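(* Let $a_1,\ldots,a_m\in\mathbb R^n$ satisfy $0\in\operatorname{rint}\operatorname{conv}\{a_1,\ldots,a_m\}$, where $\operatorname{rint}$ denotes relative interior. Let $y\in\mathbb R^m$. Then $\lim_{k\to\infty} e(p^k(y))=0$, where $p:\mathbb R^m\to\mathbb R^m$ is the map performing one cycle of coordinate minimization with the unique rule and $e:\mathbb R^m\to\mathbb R_+$ is the function measuring violation of sign consistency, both defined from $a_1,\ldots,a_m$ in the context.
   Context: Let $m,n\ge1$, $[m]=\{1,\ldots,m\}$, and let $a_i=(a_{i1},\ldots,a_{in})\in\mathbb R^n$ for $i\in[m]$. For $a\in\mathbb R^n$, $\operatorname{sgn}a\in\{-1,0,1\}^n$ is taken componentwise. Consistency: a set $S\subseteq\{-1,0,1\}^n$ is consistent in coordinate $j\in[n]$ if ($\exists s\in S$: $s_j=-1$) $\Leftrightarrow$ ($\exists t\in S$: $t_j=1$); $S$ is consistent if it is consistent in every coordinate $j\in[n]$. The empty set is consistent. The consistency closure $\operatorname{cons}S$ is the union of all consistent subsets of $S$ (it is the greatest consistent subset of $S$). Maps $p_j$ and $p$: they are defined when $\{\operatorname{sgn}a_i\mid i\in[m]\}$ is consistent (which is implied by $0\in\operatorname{rint}\operatorname{conv}\{a_1,\ldots,a_m\}$). For $j\in[n]$ and $y\in\mathbb R^m$, if some $a_{ij}\ne0$, let $x_j^*\in\mathbb R$ be the unique minimizer of the univariate function $x_j\mapsto\max_{i\mid a_{ij}\ne0}(a_{ij}x_j+y_i)$, i.e. the unique solution of $\max_{i\mid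 a_{ij}<0}(a_{ij}x_j+y_i)=\max_{i\mid a_{ij}>0}(a_{ij}x_j+y_i)$, and let $p_j(y)\in\mathbb R^m$ have components $(p_j(y))_i=a_{ij}x_j^*+y_i$, $i\in[m]$. If $a_{ij}=0$ for all $i$, then $p_j(y)=y$. Put $p=p_n\circ p_{n-1}\circ\cdots\circ p_1$, and let $p^k$ be the $k$-fold composition of $p$. Function $e$: for $y\in\mathbb R^m$ let $\max y=\max_{i\in[m]}y_i$; for $\epsilon\ge0$ let $\operatorname{argmax}^\epsilon y=\{i\in[m]\mid y_i+\epsilon\ge\max y\}$; and let $$e(y)=\inf\{\epsilon\ge0\mid \operatorname{cons}\{\operatorname{sgn}a_i\mid i\in\operatorname{argmax}^\epsilon y\}\ne\emptyset\}.$$ *)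

theory Defs
  imports "HOL-Analysis.Analysis"
begin

text \<open>
  The vectors a_1, ..., a_m are a family \<open>a :: 'm::finite \<Rightarrow> real^'n\<close>. The coordinates are indexed by a
  finite linearly ordered type \<open>'n\<close>, because one cycle of coordinate minimization visits them in
  increasing order.
\<close>

text \<open>
  The componentwise sign. The library's \<open>sgn\<close> on \<open>real^'n\<close> is a different function: it normalizes
  the vector.
\<close>
definition sgn_vec :: "real^'n \<Rightarrow> real^'n" where
  "sgn_vec v = (\<chi> j. sgn (v $ j))"

definition consistent_in :: "(real^'n) set \<Rightarrow> 'n \<Rightarrow> bool" where
  "consistent_in S j \<longleftrightarrow> ((\<exists>s\<in>S. s $ j = -1) \<longleftrightarrow> (\<exists>t\<in>S. t $ j = 1))"

definition consistent :: "(real^'n) set \<Rightarrow> bool" where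
  "consistent S \<longleftrightarrow> (\<forall>j. consistent_in S j)"

definition cons_closure :: "(real^'n) set \<Rightarrow> (real^'n) set" where
  "cons_closure S = \<Union>{T. T \<subseteq> S \<and> consistent T}"

definition coord_objective ::
    "('m::finite \<Rightarrow> real^'n) \<Rightarrow> 'n \<Rightarrow> real^'m \<Rightarrow> real \<Rightarrow> real" where
  "coord_objective a j y x = Max ((\<lambda>i. a i $ j * x + y $ i) ` {i. a i $ j \<noteq> 0})"

text \<open>
  The minimizer exists and is unique whenever some \<open>a i $ j\<close> is nonzero and the sign vectors of the
  \<open>a i\<close> are consistent in coordinate \<open>j\<close>; in all other cases the value is unspecified.
\<close>
definition coord_minimizer :: "('m::finite \<Rightarrow> real^'n) \<Rightarrow> 'n \<Rightarrow> real^'m \<Rightarrow> real" where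
  "coord_minimizer a j y = (THE x. is_arg_min (coord_objective a j y) (\<lambda>_. True) x)"

definition coord_step :: "('m::finite \<Rightarrow> real^'n) \<Rightarrow> 'n \<Rightarrow> real^'m \<Rightarrow> real^'m" where
  "coord_step a j y =
     (if \<exists>i. a i $ j \<noteq> 0 then (\<chi> i. a i $ j * coord_minimizer a j y + y $ i) else y)"

text \<open>\<open>fold\<close> applies the step for the least coordinate first.\<close>
definition coord_cycle ::
    "('m::finite \<Rightarrow> real^'n::{finite,linorder}) \<Rightarrow> real^'m \<Rightarrow> real^'m" where
  "coord_cycle a = fold (coord_step a) (sorted_list_of_set UNIV)"

definition argmax_eps :: "real \<Rightarrow> real^'m::finite \<Rightarrow> 'm set" where
  "argmax_eps \<epsilon> y = {i. y $ i + \<epsilon> \<ge> Max (range (($) y))}"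

definition consistency_error :: "('m::finite \<Rightarrow> real^'n) \<Rightarrow> real^'m \<Rightarrow> real" where
  "consistency_error a y =
     Inf {\<epsilon>. \<epsilon> \<ge> 0 \<and> cons_closure ((\<lambda>i. sgn_vec (a i)) ` argmax_eps \<epsilon> y) \<noteq> {}}"

end

theory Submission
  imports Defs
begin

text \<open>
  Since \<open>0\<close> is in the relative interior, it is a combination of the \<open>a i\<close> with positive weights
  \<open>\<lambda> i\<close>. A coordinate step preserves \<open>\<Sum>i. \<lambda> i * y i\<close> and does not increase the maximal component,
  so orbits are bounded and their maxima converge. At an accumulation point the maximum is therefore
  constant along the whole orbit. A step which leaves the maximum unchanged either leaves the set of
  maximal indices unchanged, which is then consistent in the processed coordinate, or discards from it
  the indices with nonzero entry in that coordinate. Hence the set of maximal indices shrinks along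
  the orbit until it is consistent in every coordinate, and the accumulation point has error zero.
  A maximal index of the accumulation point is almost maximal at nearby iterates, which
  makes the error of those small.
\<close>

section \<open>The maximal component\<close>

definition vec_max :: "real^'m::finite \<Rightarrow> real" where
  "vec_max y = Max (range (($) y))"

lemma component_le_vec_max: "y $ i \<le> vec_max y"
  by (simp add: vec_max_def)

lemma vec_max_le_iff: "vec_max y \<le> c \<longleftrightarrow> (\<forall>i. y $ i \<le> c)"
  by (simp add: vec_max_def)

lemma vec_max_attained: obtains i where "y $ i = vec_max y"
proof -
  have "vec_max y \<in> range (($) y)"
    unfolding vec_max_def by (rule Max_in) auto
  then show ?thesis
    using that by (metis imageE)
qed

lemma continuous_on_Max_finite:
  fixes f :: "'i \<Rightarrow> 'x::topological_space \<Rightarrow> real"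
  assumes "finite I" "I \<noteq> {}" "\<And>i. i \<in> I \<Longrightarrow> continuous_on S (f i)"
  shows "continuous_on S (\<lambda>x. Max ((\<lambda>i. f i x) ` I))"
  using assms
proof (induction I rule: finite_ne_induct)
  case (insert i I)
  have "(\<lambda>x. Max ((\<lambda>i. f i x) ` insert i I)) = (\<lambda>x. max (f i x) (Max ((\<lambda>i. f i x) ` I)))"
    using insert.hyps by (simp add: fun_eq_iff)
  then show ?case
    using insert by (auto intro!: continuous_on_max)
qed simp

lemma continuous_on_Min_finite:
  fixes f :: "'i \<Rightarrow> 'x::topological_space \<Rightarrow> real"
  assumes "finite I" "I \<noteq> {}" "\<And>i. i \<in> I \<Longrightarrow> continuous_on S (f i)"
  shows "continuous_on S (\<lambda>x. Min ((\<lambda>i. f i x) ` I))"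
  using assms
proof (induction I rule: finite_ne_induct)
  case (insert i I)
  have "(\<lambda>x. Min ((\<lambda>i. f i x) ` insert i I)) = (\<lambda>x. min (f i x) (Min ((\<lambda>i. f i x) ` I)))"
    using insert.hyps by (simp add: fun_eq_iff)
  then show ?case
    using insert by (auto intro!: continuous_on_min)
qed simp

lemma continuous_on_vec_max: "continuous_on S vec_max"
  unfolding vec_max_def by (rule continuous_on_Max_finite) (auto intro: continuous_intros)

lemma argmax_eps_zero: "argmax_eps 0 y = {i. y $ i = vec_max y}"
  using component_le_vec_max[of y]
  by (auto simp: argmax_eps_def vec_max_def[symmetric] intro: antisym)

lemma argmax_eps_zero_nonempty: "argmax_eps 0 y \<noteq> {}"
  using vec_max_attained[of y] by (auto simp: argmax_eps_zero)

section \<open>A single coordinate step\<close>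

lemma consistent_in_sgn_vec_image:
  "consistent_in ((\<lambda>i. sgn_vec (a i)) ` I) j \<longleftrightarrow>
    ((\<exists>i\<in>I. a i $ j < 0) \<longleftrightarrow> (\<exists>i\<in>I. a i $ j > 0))"
  by (auto simp: consistent_in_def sgn_vec_def sgn_1_pos sgn_1_neg)

text \<open>The form in which the relative interior hypothesis is used. Weights sit on indices
  rather than on vectors, so repeated vectors each carry their own positive weight.\<close>

locale positively_dependent =
  fixes a :: "'m::finite \<Rightarrow> real^'n" and weight :: "'m \<Rightarrow> real"
  assumes weight_pos: "weight i > 0"
    and weighted_sum: "(\<Sum>i\<in>UNIV. weight i *\<^sub>R a i) = 0"
begin

lemma weighted_sum_component: "(\<Sum>i\<in>UNIV. weight i * a i $ j) = 0"
  using arg_cong[OF weighted_sum, of "\<lambda>v. v $ j"] by simp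

lemma both_signs:
  assumes "a i $ j \<noteq> 0"
  shows "{i. a i $ j > 0} \<noteq> {}" and "{i. a i $ j < 0} \<noteq> {}"
proof -
  \<comment> \<open>Taking \<open>s\<close> as \<open>-1\<close> or \<open>1\<close> covers both
    signs: if all entries had one weak sign, every term of the vanishing weighted sum would be
    zero.\<close>
  have zero: "a i $ j = 0" if "(\<And>l. s * a l $ j \<ge> 0)" "s \<noteq> 0" for s
  proof -
    have "(\<Sum>l\<in>UNIV. weight l * (s * a l $ j)) = s * (\<Sum>l\<in>UNIV. weight l * a l $ j)"
      by (simp add: sum_distrib_left mult_ac)
    then have "(\<Sum>l\<in>UNIV. weight l * (s * a l $ j)) = 0"
      by (simp add: weighted_sum_component)
    then have "\<forall>l\<in>UNIV. weight l * (s * a l $ j) = 0"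
      using that weight_pos by (subst (asm) sum_nonneg_eq_0_iff) (auto simp: less_imp_le)
    then have "weight i * (s * a i $ j) = 0"
      by blast
    then show ?thesis
      using weight_pos[of i] that(2) by simp
  qed
  show "{i. a i $ j > 0} \<noteq> {}"
    using zero[of "-1"] assms by (force simp: not_less)
  show "{i. a i $ j < 0} \<noteq> {}"
    using zero[of 1] assms by (force simp: not_less)
qed

text \<open>
  The rising line \<open>i\<close> lies above all falling lines \<open>k\<close> exactly from the abscissa
  \<open>Max (crossings of i)\<close> on; the objective has its minimum where this first happens for some \<open>i\<close>.
\<close>
definition crossing :: "'n \<Rightarrow> real^'m \<Rightarrow> real" where
  "crossing j y = Min ((\<lambda>i. Max ((\<lambda>k. (y $ k - y $ i) / (a i $ j - a k $ j)) ` {k. a k $ j < 0}))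
     ` {i. a i $ j > 0})"

text \<open>The index \<open>i\<close> attains the outer minimum and \<open>k\<close> the inner
  maximum, so a rising and a falling line meet on the upper envelope.\<close>

lemma crossing_optimal:
  assumes "a l $ j \<noteq> 0"
  obtains i k where "a i $ j > 0" "a k $ j < 0"
    "a i $ j * crossing j y + y $ i = a k $ j * crossing j y + y $ k"
    "coord_objective a j y (crossing j y) = a i $ j * crossing j y + y $ i"
proof -
  define x where "x = crossing j y"
  define P where "P = {i. a i $ j > 0}"
  define N where "N = {k. a k $ j < 0}"
  define g where "g i = (\<lambda>k. (y $ k - y $ i) / (a i $ j - a k $ j))" for i
  have ne: "P \<noteq> {}" "N \<noteq> {}"
    using both_signs[OF assms] by (auto simp: P_def N_def)
  have x: "x = Min ((\<lambda>i. Max (g i ` N)) ` P)"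
    by (simp add: x_def crossing_def P_def N_def g_def)
  have "x \<in> (\<lambda>i. Max (g i ` N)) ` P"
    unfolding x by (rule Min_in) (use ne in auto)
  then obtain i where i: "i \<in> P" "x = Max (g i ` N)"
    by auto
  have "x \<in> g i ` N"
    unfolding i(2) by (rule Max_in) (use ne in auto)
  then obtain k where k: "k \<in> N" "x = g i k"
    by auto
  have diff: "a i' $ j - a k' $ j > 0" if "i' \<in> P" "k' \<in> N" for i' k'
    using that by (auto simp: P_def N_def)
  have ik: "a i $ j * x + y $ i = a k $ j * x + y $ k"
    using k(2) diff[OF i(1) k(1)] by (simp add: g_def field_simps)
  have falling: "a k' $ j * x + y $ k' \<le> a i $ j * x + y $ i" if "k' \<in> N" for k'
  proof -
    have "g i k' \<le> x"
      unfolding i(2) by (rule Max_ge) (use that in auto)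
    then show ?thesis
      using diff[OF i(1) that] by (simp add: g_def field_simps)
  qed
  \<comment> \<open>By minimality of \<open>x\<close>, the line \<open>i'\<close> overtakes its last
    falling line \<open>k'\<close> no earlier than \<open>x\<close>; so at \<open>x\<close> it is at
    most \<open>k'\<close>, which is at most \<open>i\<close>.\<close>
  have rising: "a i' $ j * x + y $ i' \<le> a i $ j * x + y $ i" if "i' \<in> P" for i'
  proof -
    have "Max (g i' ` N) \<in> g i' ` N"
      by (rule Max_in) (use ne in auto)
    then obtain k' where k': "k' \<in> N" "Max (g i' ` N) = g i' k'"
      by auto
    have "x \<le> g i' k'"
      unfolding x k'(2)[symmetric] by (rule Min_le) (use that in auto)
    then have "a i' $ j * x + y $ i' \<le> a k' $ j * x + y $ k'"
      using diff[OF that k'(1)] by (simp add: g_def field_simps)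
    also have "\<dots> \<le> a i $ j * x + y $ i"
      by (rule falling[OF k'(1)])
    finally show ?thesis .
  qed
  have "coord_objective a j y x = a i $ j * x + y $ i"
    unfolding coord_objective_def
  proof (rule Max_eqI)
    show "v \<le> a i $ j * x + y $ i" if v: "v \<in> (\<lambda>i. a i $ j * x + y $ i) ` {i. a i $ j \<noteq> 0}" for v
    proof -
      obtain l where "v = a l $ j * x + y $ l" "a l $ j \<noteq> 0"
        using v by auto
      moreover from this have "l \<in> P \<union> N"
        by (auto simp: P_def N_def)
      ultimately show ?thesis
        using rising falling by auto
    qed
  qed (use i(1) in \<open>auto simp: P_def\<close>)
  then show ?thesis
    using that[of i k] i k ik by (simp add: P_def N_def x_def)
qed

lemma coord_objective_ge:
  assumes "a i $ j \<noteq> 0"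
  shows "a i $ j * x + y $ i \<le> coord_objective a j y x"
  unfolding coord_objective_def by (rule Max_ge) (use assms in auto)

text \<open>To the right the rising line \<open>i\<close> already exceeds the value at the crossing,
  to the left the falling line \<open>k\<close> does. Strictness makes the minimizer unique.\<close>

lemma coord_objective_crossing_less:
  assumes "a l $ j \<noteq> 0" "x \<noteq> crossing j y"
  shows "coord_objective a j y (crossing j y) < coord_objective a j y x"
proof -
  obtain i k where ik: "a i $ j > 0" "a k $ j < 0"
    "a i $ j * crossing j y + y $ i = a k $ j * crossing j y + y $ k"
    "coord_objective a j y (crossing j y) = a i $ j * crossing j y + y $ i"
    using crossing_optimal[OF assms(1)] by blast
  consider "x > crossing j y" | "x < crossing j y"
    using assms(2) by linarith
  then show ?thesis
  proof cases
    case 1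
    then have "a i $ j * crossing j y < a i $ j * x"
      using ik(1) by simp
    then show ?thesis
      using ik(4) coord_objective_ge[OF less_imp_neq[OF ik(1), symmetric], of x y] by linarith
  next
    case 2
    then have "a k $ j * crossing j y < a k $ j * x"
      using ik(2) by simp
    then show ?thesis
      using ik(3,4) coord_objective_ge[OF less_imp_neq[OF ik(2)], of x y] by linarith
  qed
qed

lemma coord_minimizer_eq_crossing:
  assumes "a l $ j \<noteq> 0"
  shows "coord_minimizer a j y = crossing j y"
  unfolding coord_minimizer_def
proof (rule the_equality)
  show "is_arg_min (coord_objective a j y) (\<lambda>_. True) (crossing j y)"
    using coord_objective_crossing_less[OF assms] by (auto simp: is_arg_min_def) (metis less_asym less_irrefl)
  show "x = crossing j y" if "is_arg_min (coord_objective a j y) (\<lambda>_. True) x" for x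
    using that coord_objective_crossing_less[OF assms] by (auto simp: is_arg_min_def)
qed

text \<open>The explicit formula yields continuity: finite minima and maxima of linear functions of
  \<open>y\<close>, with constant positive denominators.\<close>

lemma continuous_on_crossing:
  assumes "a l $ j \<noteq> 0"
  shows "continuous_on S (crossing j)"
  unfolding crossing_def
proof (intro continuous_on_Min_finite continuous_on_Max_finite)
  show "continuous_on S (\<lambda>y. (y $ k - y $ i) / (a i $ j - a k $ j))"
    if "i \<in> {i. a i $ j > 0}" "k \<in> {k. a k $ j < 0}" for i k
    using that by (auto intro!: continuous_intros)
qed (use both_signs[OF assms] in auto)

lemma coord_step_component:
  assumes "a l $ j \<noteq> 0"
  shows "coord_step a j y $ i = a i $ j * crossing j y + y $ i"
  using assms by (auto simp: coord_step_def coord_minimizer_eq_crossing[OF assms])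

lemma continuous_on_coord_step: "continuous_on S (coord_step a j)"
proof (cases "\<exists>l. a l $ j \<noteq> 0")
  case True
  then obtain l where l: "a l $ j \<noteq> 0" ..
  have "coord_step a j = (\<lambda>y. \<chi> i. a i $ j * crossing j y + y $ i)"
    by (auto simp: fun_eq_iff vec_eq_iff coord_step_component[OF l])
  then show ?thesis
    by (auto intro!: continuous_intros continuous_on_crossing[OF l])
next
  case False
  then show ?thesis
    by (simp add: coord_step_def[abs_def])
qed

text \<open>The step adds a multiple of the column of \<open>j\<close>-th entries, which is
  orthogonal to the weights.\<close>

lemma weighted_sum_coord_step:
  "(\<Sum>i\<in>UNIV. weight i * coord_step a j y $ i) = (\<Sum>i\<in>UNIV. weight i * y $ i)"
proof (cases "\<exists>l. a l $ j \<noteq> 0")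
  case True
  then obtain l where l: "a l $ j \<noteq> 0" ..
  have "(\<Sum>i\<in>UNIV. weight i * coord_step a j y $ i)
      = crossing j y * (\<Sum>i\<in>UNIV. weight i * a i $ j) + (\<Sum>i\<in>UNIV. weight i * y $ i)"
    by (simp add: coord_step_component[OF l] algebra_simps sum.distrib sum_distrib_left)
  then show ?thesis
    by (simp add: weighted_sum_component)
next
  case False
  then show ?thesis
    by (simp add: coord_step_def)
qed

text \<open>Compare with \<open>x = 0\<close>, where the objective is a maximum over some components
  of \<open>y\<close>; a minimizer other than 0 is strictly better.\<close>

lemma coord_objective_crossing_le:
  assumes "a l $ j \<noteq> 0"
  shows "coord_objective a j y (crossing j y) \<le> vec_max y"
    and "crossing j y \<noteq> 0 \<Longrightarrow> coord_objective a j y (crossing j y) < vec_max y"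
proof -
  have "coord_objective a j y 0 \<le> vec_max y"
    unfolding coord_objective_def using assms
    by (subst Max_le_iff) (auto simp: component_le_vec_max)
  moreover have "coord_objective a j y (crossing j y) < coord_objective a j y 0"
    if "crossing j y \<noteq> 0"
    using coord_objective_crossing_less[OF assms] that by metis
  ultimately show "coord_objective a j y (crossing j y) \<le> vec_max y"
    and "crossing j y \<noteq> 0 \<Longrightarrow> coord_objective a j y (crossing j y) < vec_max y"
    by (cases "crossing j y = 0"; force)+
qed

lemma vec_max_coord_step_le: "vec_max (coord_step a j y) \<le> vec_max y"
proof (cases "\<exists>l. a l $ j \<noteq> 0")
  case True
  then obtain l where l: "a l $ j \<noteq> 0" ..
  have "coord_step a j y $ i \<le> vec_max y" for i
    using coord_objective_ge[of i j "crossing j y" y] coord_objective_crossing_le(1)[OF l, of y]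
      component_le_vec_max[of y i]
    by (cases "a i $ j = 0") (auto simp: coord_step_component[OF l])
  then show ?thesis
    by (simp add: vec_max_le_iff)
next
  case False
  then show ?thesis
    by (simp add: coord_step_def)
qed

lemma argmax_coord_step:
  assumes "vec_max (coord_step a j y) = vec_max y"
  shows "argmax_eps 0 (coord_step a j y) \<subseteq> argmax_eps 0 y"
    and "argmax_eps 0 (coord_step a j y) = argmax_eps 0 y \<Longrightarrow>
      consistent_in ((\<lambda>i. sgn_vec (a i)) ` argmax_eps 0 y) j"
proof -
  let ?x = "crossing j y" and ?z = "coord_step a j y"
  have "argmax_eps 0 ?z \<subseteq> argmax_eps 0 y \<and>
    (argmax_eps 0 ?z = argmax_eps 0 y \<longrightarrow>
      consistent_in ((\<lambda>i. sgn_vec (a i)) ` argmax_eps 0 y) j)"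
  proof (cases "\<exists>l. a l $ j \<noteq> 0")
    case True
    then obtain l where l: "a l $ j \<noteq> 0" ..
    obtain i k where ik: "a i $ j > 0" "a k $ j < 0"
      "a i $ j * ?x + y $ i = a k $ j * ?x + y $ k"
      "coord_objective a j y ?x = a i $ j * ?x + y $ i"
      using crossing_optimal[OF l] by blast
    show ?thesis
    proof (cases "coord_objective a j y ?x < vec_max y")
      case True
      \<comment> \<open>Every index with nonzero entry ends strictly below the unchanged maximum.
        The remaining maximal indices have entry zero, hence kept their value.\<close>
      have "a i $ j = 0" if "i \<in> argmax_eps 0 ?z" for i
      proof (rule ccontr)
        assume "a i $ j \<noteq> 0"
        then show False
          using that True coord_objective_ge[of i j ?x y]
          by (simp add: argmax_eps_zero assms coord_step_component[OF l])
      qed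
      then show ?thesis
        unfolding consistent_in_sgn_vec_image
        by (force simp: argmax_eps_zero assms coord_step_component[OF l])
    next
      case False
      \<comment> \<open>The minimizer is 0, so the step is the identity, and the two lines meeting
        on the envelope are maximal indices of opposite sign.\<close>
      then have eq: "?x = 0" "coord_objective a j y ?x = vec_max y"
        using coord_objective_crossing_le[OF l, of y] by force+
      then have "?z = y"
        by (simp add: vec_eq_iff coord_step_component[OF l])
      moreover have "i \<in> argmax_eps 0 y" "k \<in> argmax_eps 0 y"
        using ik eq by (simp_all add: argmax_eps_zero)
      ultimately show ?thesis
        unfolding consistent_in_sgn_vec_image using ik by auto
    qed
  next
    case False
    then show ?thesis
      unfolding consistent_in_sgn_vec_image by (simp add: coord_step_def)
  qed
  then show "argmax_eps 0 ?z \<subseteq> argmax_eps 0 y"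
    and "argmax_eps 0 ?z = argmax_eps 0 y \<Longrightarrow>
      consistent_in ((\<lambda>i. sgn_vec (a i)) ` argmax_eps 0 y) j"
    by auto
qed

section \<open>Sweeps over several coordinates\<close>

lemma continuous_on_coord_sweep: "continuous_on UNIV (fold (coord_step a) js)"
proof (induction js)
  case (Cons j js)
  have "continuous_on UNIV (fold (coord_step a) js \<circ> coord_step a j)"
    by (intro continuous_on_compose continuous_on_coord_step)
      (rule continuous_on_subset[OF Cons], simp)
  then show ?case
    by simp
qed (simp add: id_def)

lemma weighted_sum_coord_sweep:
  "(\<Sum>i\<in>UNIV. weight i * fold (coord_step a) js y $ i) = (\<Sum>i\<in>UNIV. weight i * y $ i)"
  by (induction js arbitrary: y) (simp_all add: weighted_sum_coord_step)

lemma vec_max_coord_sweep_le: "vec_max (fold (coord_step a) js y) \<le> vec_max y"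
proof (induction js arbitrary: y)
  case (Cons j js)
  show ?case
    using Cons[of "coord_step a j y"] vec_max_coord_step_le[of j y] by simp
qed simp

text \<open>The argmax sets form a decreasing chain along the sweep. If its ends agree, all its
  members agree, so the consistency conditions of all steps concern the same set.\<close>

lemma argmax_coord_sweep:
  assumes "vec_max (fold (coord_step a) js y) = vec_max y"
  shows "argmax_eps 0 (fold (coord_step a) js y) \<subseteq> argmax_eps 0 y \<and>
    (argmax_eps 0 (fold (coord_step a) js y) = argmax_eps 0 y \<longrightarrow>
      (\<forall>j\<in>set js. consistent_in ((\<lambda>i. sgn_vec (a i)) ` argmax_eps 0 y) j))"
  using assms
proof (induction js arbitrary: y)
  case (Cons j js)
  let ?z = "coord_step a j y"
  \<comment> \<open>The maximum never increases, so equality over the whole sweep forces equality in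
    each part.\<close>
  have "vec_max ?z = vec_max y" "vec_max (fold (coord_step a) js ?z) = vec_max ?z"
    using Cons.prems vec_max_coord_sweep_le[of js ?z] vec_max_coord_step_le[of j y] by auto
  then show ?case
    using Cons.IH[of ?z] argmax_coord_step[of j y] by auto
qed simp

end

section \<open>Convergence\<close>

text \<open>From each \<open>a i\<close> the segment through 0 can be prolonged inside the hull,
  which gives a nonnegative relation with positive weight at \<open>i\<close>. Summing these
  relations over \<open>i\<close> makes all weights positive.\<close>

lemma zero_in_rel_interior_weights:
  fixes a :: "'m::finite \<Rightarrow> real^'n"
  assumes "0 \<in> rel_interior (convex hull (range a))"
  obtains weight where "positively_dependent a weight"
proof -
  have "\<exists>w. (\<forall>l. w l \<ge> 0) \<and> w i > 0 \<and> (\<Sum>l\<in>UNIV. w l *\<^sub>R a l) = 0" for i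
  proof -
    have "a i \<in> convex hull (range a)"
      by (simp add: hull_inc)
    then obtain e where e: "e > 1" "(1 - e) *\<^sub>R a i \<in> convex hull (range a)"
      using assms by (auto simp: convex_rel_interior_iff)
    then obtain u where u: "\<forall>v\<in>range a. 0 \<le> u v"
      "(\<Sum>v\<in>range a. u v *\<^sub>R v) = (1 - e) *\<^sub>R a i"
      by (auto simp: convex_hull_finite)
    txt \<open>The family \<open>a\<close> need not be injective, so the weight of a vector goes to one chosen index.\<close>
    define r where "r = inv a"
    have r: "a (r v) = v" if "v \<in> range a" for v
      using that by (simp add: r_def f_inv_into_f)
    have inj: "inj_on r (range a)"
      by (simp add: r_def inj_on_inv_into)
    \<comment> \<open>The first part represents \<open>(1 - e) *\<^sub>R a i\<close>; the extra
      weight \<open>e - 1\<close> at \<open>i\<close> cancels it and is positive.\<close>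
    define w where "w l = (if l \<in> r ` range a then u (a l) else 0) + (if l = i then e - 1 else 0)"
      for l
    have "(\<Sum>l\<in>UNIV. w l *\<^sub>R a l)
        = (\<Sum>l\<in>UNIV. if l \<in> r ` range a then u (a l) *\<^sub>R a l else 0)
          + (\<Sum>l\<in>UNIV. if l = i then (e - 1) *\<^sub>R a l else 0)"
      unfolding sum.distrib[symmetric] by (rule sum.cong) (auto simp: w_def scaleR_left_distrib)
    also have "(\<Sum>l\<in>UNIV. if l \<in> r ` range a then u (a l) *\<^sub>R a l else 0)
        = (\<Sum>l\<in>r ` range a. u (a l) *\<^sub>R a l)"
      by (subst sum.inter_restrict[symmetric]) auto
    also have "\<dots> = (\<Sum>v\<in>range a. u v *\<^sub>R v)"
      by (subst sum.reindex[OF inj]) (auto intro!: sum.cong simp: r)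
    also have "\<dots> + (\<Sum>l\<in>UNIV. if l = i then (e - 1) *\<^sub>R a l else 0) = 0"
      unfolding u(2) by (simp add: scaleR_left_distrib[symmetric])
    finally have "(\<Sum>l\<in>UNIV. w l *\<^sub>R a l) = 0" .
    moreover have "\<forall>l. w l \<ge> 0" "w i > 0"
      using u(1) e(1) by (auto simp: w_def add_nonneg_pos)
    ultimately show ?thesis
      by blast
  qed
  then obtain w where w: "\<And>i l. w i l \<ge> 0" "\<And>i. w i i > 0"
    "\<And>i. (\<Sum>l\<in>UNIV. w i l *\<^sub>R a l) = 0"
    by metis
  have "positively_dependent a (\<lambda>l. \<Sum>i\<in>UNIV. w i l)"
  proof
    show "(\<Sum>i\<in>UNIV. w i l) > 0" for l
      by (rule sum_pos2[of _ l]) (auto simp: w)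
    have "(\<Sum>l\<in>UNIV. (\<Sum>i\<in>UNIV. w i l) *\<^sub>R a l) = (\<Sum>i\<in>UNIV. \<Sum>l\<in>UNIV. w i l *\<^sub>R a l)"
      unfolding scaleR_left.sum by (rule sum.swap)
    then show "(\<Sum>l\<in>UNIV. (\<Sum>i\<in>UNIV. w i l) *\<^sub>R a l) = 0"
      by (simp add: w)
  qed
  then show ?thesis
    by (rule that)
qed

lemma consistency_error_bounds:
  assumes "\<epsilon> \<ge> 0" "consistent T" "T \<noteq> {}" "T \<subseteq> (\<lambda>i. sgn_vec (a i)) ` argmax_eps \<epsilon> y"
  shows "0 \<le> consistency_error a y" and "consistency_error a y \<le> \<epsilon>"
proof -
  let ?E = "{\<epsilon>. \<epsilon> \<ge> 0 \<and> cons_closure ((\<lambda>i. sgn_vec (a i)) ` argmax_eps \<epsilon> y) \<noteq> {}}"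
  \<comment> \<open>\<open>T\<close> lies in the closure. Membership also shows that the infimum is
    over a nonempty set, which the lower bound 0 relies on.\<close>
  have mem: "\<epsilon> \<in> ?E"
    using assms by (auto simp: cons_closure_def)
  then show "0 \<le> consistency_error a y"
    unfolding consistency_error_def by (intro cInf_greatest) auto
  show "consistency_error a y \<le> \<epsilon>"
    unfolding consistency_error_def by (rule cInf_lower[OF mem]) (auto intro: bdd_belowI)
qed

section \<open>Orbits of the full cycle and their accumulation points\<close>

context
  fixes a :: "'m::finite \<Rightarrow> real^'n::{finite,linorder}" and weight :: "'m \<Rightarrow> real"
  assumes dependent: "positively_dependent a weight"
begin

interpretation positively_dependent a weight
  by (rule dependent)

lemma continuous_on_coord_cycle_funpow: "continuous_on UNIV (coord_cycle a ^^ k)"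
proof (induction k)
  case (Suc k)
  have "continuous_on UNIV (coord_cycle a \<circ> (coord_cycle a ^^ k))"
    by (intro continuous_on_compose Suc)
      (auto simp: coord_cycle_def intro: continuous_on_subset[OF continuous_on_coord_sweep])
  then show ?case
    by simp
qed (simp add: id_def)

lemma decseq_vec_max_orbit: "decseq (\<lambda>k. vec_max ((coord_cycle a ^^ k) y))"
  by (rule decseq_SucI) (simp add: coord_cycle_def vec_max_coord_sweep_le)

lemma orbit_lower_bound:
  obtains B where "\<And>k i. B \<le> (coord_cycle a ^^ k) y $ i"
proof -
  define c where "c = (\<Sum>i\<in>UNIV. weight i * y $ i)"
  \<comment> \<open>The invariant weighted sum \<open>c\<close>, solved for component
    \<open>i\<close> with all other components at their upper bound
    \<open>vec_max y\<close>.\<close>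
  define b where "b i = (c - (\<Sum>l\<in>UNIV - {i}. weight l * vec_max y)) / weight i" for i
  have "b i \<le> (coord_cycle a ^^ k) y $ i" for i k
  proof -
    let ?z = "(coord_cycle a ^^ k) y"
    have "vec_max ?z \<le> vec_max y"
      using decseqD[OF decseq_vec_max_orbit[of y], of 0 k] by simp
    then have le: "?z $ l \<le> vec_max y" for l
      using component_le_vec_max[of ?z l] by linarith
    have "c = (\<Sum>l\<in>UNIV. weight l * ?z $ l)"
      by (induction k) (simp_all add: c_def coord_cycle_def weighted_sum_coord_sweep)
    also have "\<dots> = weight i * ?z $ i + (\<Sum>l\<in>UNIV - {i}. weight l * ?z $ l)"
      by (rule sum.remove) auto
    also have "(\<Sum>l\<in>UNIV - {i}. weight l * ?z $ l) \<le> (\<Sum>l\<in>UNIV - {i}. weight l * vec_max y)"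
      by (intro sum_mono mult_left_mono le less_imp_le weight_pos)
    finally show ?thesis
      using weight_pos[of i] by (simp add: b_def field_simps)
  qed
  then have "Min (range b) \<le> (coord_cycle a ^^ k) y $ i" for i k
    by (meson Min_le finite finite_imageI order_trans rangeI)
  then show ?thesis
    by (rule that)
qed

lemma bounded_orbit: "bounded (range (\<lambda>k. (coord_cycle a ^^ k) y))"
proof -
  obtain B where B: "\<And>k i. B \<le> (coord_cycle a ^^ k) y $ i"
    using orbit_lower_bound by blast
  have "(coord_cycle a ^^ k) y $ i \<le> vec_max y" for k i
    using component_le_vec_max[of "(coord_cycle a ^^ k) y" i]
      decseqD[OF decseq_vec_max_orbit[of y], of 0 k] by simp
  then have "range (\<lambda>k. (coord_cycle a ^^ k) y) \<subseteq> cbox (\<chi> i. B) (\<chi> i. vec_max y)"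
    using B by (auto simp: mem_box_cart)
  then show ?thesis
    by (rule bounded_subset[OF bounded_cbox])
qed

lemma convergent_vec_max_orbit: "convergent (\<lambda>k. vec_max ((coord_cycle a ^^ k) y))"
proof -
  obtain B where B: "\<And>k i. B \<le> (coord_cycle a ^^ k) y $ i"
    using orbit_lower_bound by blast
  have "B \<le> vec_max ((coord_cycle a ^^ k) y)" for k
    using B[of k] component_le_vec_max by (rule order_trans)
  then show ?thesis
    using decseq_convergent[OF decseq_vec_max_orbit] by (metis convergentI)
qed

lemma consistent_subset_of_constant_max:
  assumes "\<And>k. vec_max ((coord_cycle a ^^ k) y) = vec_max y"
  obtains T where "consistent T" "T \<noteq> {}" "T \<subseteq> (\<lambda>i. sgn_vec (a i)) ` argmax_eps 0 y"
proof -
  define A where "A k = argmax_eps 0 ((coord_cycle a ^^ k) y)" for k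
  have max_eq: "vec_max (fold (coord_step a) (sorted_list_of_set UNIV) ((coord_cycle a ^^ k) y))
      = vec_max ((coord_cycle a ^^ k) y)" for k
    using assms[of k] assms[of "Suc k"] by (simp add: coord_cycle_def)
  note sweep = argmax_coord_sweep[OF max_eq]
  have dec: "A (Suc k) \<subseteq> A k" for k
    using sweep[of k] by (simp add: A_def coord_cycle_def)
  \<comment> \<open>A decreasing chain of finite sets is stationary at a member of least
    cardinality.\<close>
  obtain k where k: "card (A k) \<le> card (A k')" for k'
    using ex_has_least_nat[of "\<lambda>_. True" 0 "\<lambda>k. card (A k)"] by auto
  have "A (Suc k) = A k"
    by (rule card_seteq[OF _ dec k]) simp
  then have "consistent ((\<lambda>i. sgn_vec (a i)) ` A k)"
    using sweep[of k] by (simp add: A_def coord_cycle_def consistent_def)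
  moreover have "A k \<subseteq> A 0"
    using lift_Suc_antimono_le[of A 0 k] dec by simp
  moreover have "A k \<noteq> {}"
    by (simp add: A_def argmax_eps_zero_nonempty)
  ultimately show ?thesis
    using that[of "(\<lambda>i. sgn_vec (a i)) ` A k"] by (auto simp: A_def)
qed

text \<open>By continuity, the maximum at the \<open>k\<close>-th iterate of \<open>z\<close> is the
  limit of the maxima along the shifted subsequence \<open>k + r n\<close> of the orbit of
  \<open>y\<close>, and this limit is \<open>L\<close> for every \<open>k\<close>.\<close>

lemma accumulation_point_constant_max:
  assumes "strict_mono r" and lim: "(\<lambda>n. (coord_cycle a ^^ r n) y) \<longlonglongrightarrow> z"
  shows "vec_max ((coord_cycle a ^^ k) z) = vec_max z"
proof -
  obtain L where L: "(\<lambda>k. vec_max ((coord_cycle a ^^ k) y)) \<longlonglongrightarrow> L"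
    using convergent_vec_max_orbit convergent_def by blast
  have "vec_max ((coord_cycle a ^^ k) z) = L" for k
  proof (rule LIMSEQ_unique)
    have "continuous_on UNIV (\<lambda>x. vec_max ((coord_cycle a ^^ k) x))"
      using continuous_on_compose[OF continuous_on_coord_cycle_funpow continuous_on_vec_max]
      by (simp add: o_def)
    then have "(\<lambda>n. vec_max ((coord_cycle a ^^ k) ((coord_cycle a ^^ r n) y)))
        \<longlonglongrightarrow> vec_max ((coord_cycle a ^^ k) z)"
      by (rule continuous_on_tendsto_compose[OF _ lim]) auto
    then show "(\<lambda>n. vec_max ((coord_cycle a ^^ (k + r n)) y))
        \<longlonglongrightarrow> vec_max ((coord_cycle a ^^ k) z)"
      by (simp add: funpow_add)
    have "strict_mono (\<lambda>n. k + r n)"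
      using assms(1) by (simp add: strict_mono_def)
    then show "(\<lambda>n. vec_max ((coord_cycle a ^^ (k + r n)) y)) \<longlonglongrightarrow> L"
      using LIMSEQ_subseq_LIMSEQ[OF L] by (auto simp: o_def)
  qed
  from this[of k] this[of 0] show ?thesis
    by simp
qed

end

text \<open>One \<open>\<delta>\<close> pays for the change of the maximum, the other for the change
  of the component.\<close>

lemma argmax_eps_near:
  assumes "dist y z < \<delta>"
  shows "argmax_eps 0 z \<subseteq> argmax_eps (2 * \<delta>) y"
proof -
  have near: "\<bar>y $ i - z $ i\<bar> < \<delta>" for i
    using component_le_norm_cart[of "y - z" i] assms by (simp add: dist_norm)
  have "vec_max y \<le> vec_max z + \<delta>"
    unfolding vec_max_le_iff
    using near component_le_vec_max[of z] by (smt (verit))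
  then have "vec_max y \<le> y $ i + 2 * \<delta>" if "z $ i = vec_max z" for i
    using near[of i] that by linarith
  then show ?thesis
    by (auto simp: argmax_eps_zero) (simp add: argmax_eps_def vec_max_def)
qed

theorem theorem10:
  fixes a :: "'m::finite \<Rightarrow> real^'n::{finite,linorder}"
    and y :: "real^'m"
  assumes "0 \<in> rel_interior (convex hull (range a))"
  shows "(\<lambda>k. consistency_error a ((coord_cycle a ^^ k) y)) \<longlonglongrightarrow> 0"
proof (rule ccontr)
  obtain weight where dependent: "positively_dependent a weight"
    using zero_in_rel_interior_weights[OF assms] .
  let ?y = "\<lambda>k. (coord_cycle a ^^ k) y"
  assume "\<not> (\<lambda>k. consistency_error a (?y k)) \<longlonglongrightarrow> 0"
  then obtain \<epsilon> where \<epsilon>: "\<epsilon> > 0" "\<not> eventually (\<lambda>k. dist (consistency_error a (?y k)) 0 < \<epsilon>) sequentially"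
    by (auto simp: tendsto_iff)
  \<comment> \<open>The error stays at least \<open>\<epsilon>\<close> along \<open>r\<close>;
    compactness then gives a further subsequence \<open>s\<close> with limit
    \<open>z\<close>.\<close>
  obtain r :: "nat \<Rightarrow> nat" where r: "strict_mono r" "\<And>n. \<bar>consistency_error a (?y (r n))\<bar> \<ge> \<epsilon>"
    using not_eventually_sequentiallyD[OF \<epsilon>(2)] by (auto simp: not_less)
  have "bounded (range (?y \<circ> r))"
    by (rule bounded_subset[OF bounded_orbit[OF dependent, of y]]) auto
  then obtain z s where s: "strict_mono s" "(?y \<circ> r \<circ> s) \<longlonglongrightarrow> z"
    using bounded_imp_convergent_subsequence by blast
  have "strict_mono (r \<circ> s)" "(\<lambda>n. ?y ((r \<circ> s) n)) \<longlonglongrightarrow> z"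
    using strict_mono_o[OF r(1) s(1)] s(2) by (simp_all add: o_def)
  then have "vec_max ((coord_cycle a ^^ k) z) = vec_max z" for k
    by (rule accumulation_point_constant_max[OF dependent])
  then obtain T where T: "consistent T" "T \<noteq> {}" "T \<subseteq> (\<lambda>i. sgn_vec (a i)) ` argmax_eps 0 z"
    using consistent_subset_of_constant_max[OF dependent] by blast
  \<comment> \<open>After the doubling in \<open>argmax_eps_near\<close>, a quarter gives an error
    of at most half of \<open>\<epsilon>\<close>, a contradiction.\<close>
  have "eventually (\<lambda>n. dist (?y (r (s n))) z < \<epsilon> / 4) sequentially"
    using tendstoD[OF s(2), of "\<epsilon> / 4"] \<epsilon>(1) by simp
  then obtain n where "dist (?y (r (s n))) z < \<epsilon> / 4"
    by (meson eventually_happens' sequentially_bot)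
  from argmax_eps_near[OF this]
  have sub: "T \<subseteq> (\<lambda>i. sgn_vec (a i)) ` argmax_eps (2 * (\<epsilon> / 4)) (?y (r (s n)))"
    using T(3) by blast
  have "\<bar>consistency_error a (?y (r (s n)))\<bar> \<le> 2 * (\<epsilon> / 4)"
    using consistency_error_bounds[OF _ T(1,2) sub] \<epsilon>(1) by simp
  then show False
    using r(2)[of "s n"] \<epsilon>(1) by simp
qed

end
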